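(* Let $a,b>0$ be real numbers and $0\le p\le 1$. Then $$d_p(a,b)\le (1-p)\frac{(a-b)^2}{b}.$$
   Context: For real $a,b>0$ and $0\le p\le 1$, $d_p(a,b):=pa+(1-p)b-a^pb^{1-p}$. *)

theory Defs
  imports Complex_Main
begin

text \<open>The gap in the weighted arithmetic-geometric mean inequality; only meaningful for
  \<open>a, b > 0\<close> and \<open>0 \<le> p \<le> 1\<close>.\<close>

definition d :: "real \<Rightarrow> real \<Rightarrow> real \<Rightarrow> real" where
  "d p a b = p * a + (1 - p) * b - a powr p * b powr (1 - p)"

end

theory Submission
  imports Defs
begin

text \<open>Pulling the factor \<open>a\<close> out of the geometric mean leaves a power of \<open>b / a\<close> with exponent
  \<open>1 - p\<close>, that is, \<open>exp (- (1 - p) * ln (a / b))\<close>. Bounding the exponential and then the logarithm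
  by their tangent lines turns this factor into an affine function of \<open>a / b\<close>. Both tangents touch
  at \<open>a = b\<close>, and what remains after subtraction is exactly the quadratic term
  \<open>(1 - p) * (a - b)\<^sup>2 / b\<close>.\<close>

text \<open>The left-hand side is the tangent line at \<open>b\<close> of the convex function
  \<open>x \<mapsto> x powr (p - 1) * b powr (1 - p)\<close>, evaluated at \<open>a\<close> and multiplied by \<open>a\<close>.\<close>

lemma weighted_geometric_mean_lower_bound:
  fixes a b p :: real
  assumes "a > 0" and "b > 0" and "p \<le> 1"
  shows "a * (1 - (1 - p) * (a / b - 1)) \<le> a powr p * b powr (1 - p)"
proof -
  have "ln (a / b) \<le> a / b - 1"
    using assms by (simp add: ln_le_minus_one)
  then have "(1 - p) * ln (a / b) \<le> (1 - p) * (a / b - 1)"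
    using assms by (intro mult_left_mono) auto
  then have "1 - (1 - p) * (a / b - 1) \<le> 1 + - ((1 - p) * ln (a / b))"
    by simp
  also have "\<dots> \<le> exp (- ((1 - p) * ln (a / b)))"
    by (rule exp_ge_add_one_self)
  finally have "a * (1 - (1 - p) * (a / b - 1)) \<le> a * exp (- ((1 - p) * ln (a / b)))"
    using assms by (intro mult_left_mono) auto
  also have "\<dots> = exp (ln a + - ((1 - p) * ln (a / b)))"
    using assms by (simp only: exp_add exp_ln)
  also have "\<dots> = exp (p * ln a + (1 - p) * ln b)"
    using assms by (simp add: ln_div algebra_simps)
  also have "\<dots> = a powr p * b powr (1 - p)"
    using assms by (simp add: powr_def exp_add)
  finally show ?thesis .
qed

theorem theorem2p9:
  fixes a b p :: real
  assumes "a > 0" and "b > 0" and "0 \<le> p" and "p \<le> 1"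
  shows "d p a b \<le> (1 - p) * ((a - b)\<^sup>2 / b)"
proof -
  have "d p a b \<le> p * a + (1 - p) * b - a * (1 - (1 - p) * (a / b - 1))"
    using weighted_geometric_mean_lower_bound[of a b p] assms by (simp add: d_def)
  also have "\<dots> = (1 - p) * ((a - b)\<^sup>2 / b)"
    using assms by (simp add: field_simps power2_eq_square)
  finally show ?thesis .
qed

end
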